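(* The modified Cartier operator $\mathcal C'$ stabilizes $\varOmega[C]$ and $\varOmega[\widetilde C]$. More generally, $\mathcal C'$ stabilizes $\varOmega[C]_P$ for any closed point $P\in C$.
   Context: Let $K$ be a perfect field of characteristic $p>0$, $N\ge1$ an integer not divisible by $p$, and $f(x)=x^{A_0}(x-\lambda_1)^{A_1}\cdots(x-\lambda_r)^{A_r}\in K[x]$ with integers $A_i\ge1$, with $\lambda_0:=0,\lambda_1,\dots,\lambda_r\in\overline K$ pairwise distinct, and $\gcd(N,A_0,\dots,A_r)=1$. $C\subset\mathbb P^2_K=\mathrm{Proj}\,K[x_0,x_1,x_2]$ is the projective closure of the (irreducible) affine curve $y^N=f(x)$ ($x=x_1/x_0$, $y=x_2/x_0$), and $\pi:X\to C$ is its desingularization: $X$ is the nonsingular projective curve with function field $K(x,y)$. If $N>\sum_k A_k$ put $P_\infty=(0:1:0)$, if $N<\sum_k A_k$ put $P_\infty=(0:0:1)$; this is the unique point of $C$ at infinity. $\widetilde C$ is the partial desingularization of $C$ only at $P_\infty$: it is the curve obtained by gluing $C\setminus\{P_\infty\}$ with $\pi^{-1}(C\setminus S)\subset X$, where $S\subset C$ is the set of points of the affine curve with $y=0$, along their common open subset. If $N=\sum_k A_k$, all points of $C$ at infinity are nonsingular and $\widetilde C=C$. Let $\widetilde\pi:X\to\widetilde C$ be the natural morphism. $\varOmega(C)=\varOmega(X)$ is the space of rational differential forms of $K(x,y)$. Following Serre, for a closed point $P\in C$, $$\varOmega[C]_P=\left\{\omega\in\varOmega(X)\;;\;\sum_{\pi(Q)=P}\mathrm{res}_Q(\pi^*(h)\omega)=0\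 \text{for all }h\in\mathcal O_{C,P}\right\},\qquad \varOmega[C]=\bigcap_{P\in C}\varOmega[C]_P,$$ where $\mathrm{res}_Q$ is the usual residue at a closed point (with values in $K$); $\varOmega[\widetilde C]$ is defined in the same way with $\widetilde C,\widetilde\pi$ in place of $C,\pi$. Modified Cartier operator: every $\omega\in\varOmega(C)$ can be written $\omega=d\phi+\eta^px^{p-1}dx$ with $\phi,\eta\in K(x,y)$, $\eta^p\in K(x^p,y^p)$, and $\mathcal C':\varOmega(C)\to\varOmega(C)$ is defined by $\mathcal C'(\omega)=\eta\,dx$. *)

theory Defs
  imports
    "HOL-Algebra.Algebraic_Closure_Type"
    "HOL-Algebra.Generated_Fields"
    "HOL-Algebra.Generated_Rings"
begin

section \<open>Ground field and function field\<close>

text \<open>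
  The ground field \<open>K\<close> is a type \<open>'k\<close>, the function field \<open>F\<close> is a type \<open>'f\<close>, and
  \<open>F\<close> is an extension of \<open>K\<close> through a ring homomorphism \<open>\<iota>\<close>. Subrings and ideals of \<open>F\<close> are
  sets, handled with the notions of HOL-Algebra for the ring structure on the type.
\<close>

definition perfect_field :: "'k::field itself \<Rightarrow> bool" where
  "perfect_field _ \<longleftrightarrow> CHAR('k) = 0 \<or> surj (\<lambda>a::'k. a ^ CHAR('k))"

abbreviation type_ring :: "'a::ring_1 ring" where
  "type_ring \<equiv> ring_of_type_algebra"

abbreviation on_subring :: "'a::ring_1 set \<Rightarrow> 'a ring" where
  "on_subring R \<equiv> type_ring\<lparr>carrier := R\<rparr>"

definition field_adjoin :: "('k::field \<Rightarrow> 'f::field) \<Rightarrow> 'f set \<Rightarrow> 'f set" where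
  "field_adjoin \<iota> S = generate_field type_ring (range \<iota> \<union> S)"

definition ring_adjoin :: "('k::field \<Rightarrow> 'f::field) \<Rightarrow> 'f set \<Rightarrow> 'f set" where
  "ring_adjoin \<iota> S = generate_ring type_ring (range \<iota> \<union> S)"

text \<open>\<open>F = K(x, y)\<close> with \<open>x\<close> transcendental over \<open>K\<close> and \<open>y\<^sup>N = f(x)\<close>.\<close>

definition is_function_field ::
  "('k::field \<Rightarrow> 'f::field) \<Rightarrow> nat \<Rightarrow> 'k poly \<Rightarrow> 'f \<Rightarrow> 'f \<Rightarrow> bool" where
  "is_function_field \<iota> N f x y \<longleftrightarrow>
     \<iota> \<in> ring_hom type_ring type_ring \<and>
     (\<forall>q. poly (map_poly \<iota> q) x = 0 \<longrightarrow> q = 0) \<and>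
     y ^ N = poly (map_poly \<iota> f) x \<and>
     field_adjoin \<iota> {x, y} = UNIV"


section \<open>Differential forms\<close>

definition derivation :: "('k::field \<Rightarrow> 'f::field) \<Rightarrow> ('f \<Rightarrow> 'f) \<Rightarrow> bool" where
  "derivation \<iota> D \<longleftrightarrow>
     (\<forall>a b. D (a + b) = D a + D b) \<and> (\<forall>a b. D (a * b) = a * D b + b * D a) \<and> (\<forall>c. D (\<iota> c) = 0)"

text \<open>
  The module of differentials of \<open>F/K\<close>: an \<open>F\<close>-vector space \<open>\<Omega>\<close> (the type \<open>'w\<close>) with a universal
  \<open>K\<close>-derivation \<open>d\<close>. It is enough to require that the \<open>F\<close>-valued derivations factor through \<open>d\<close>:
  by the condition on the span, \<open>\<Omega>\<close> is a quotient of the module of Kaehler differentials, and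
  the kernel of the quotient map is killed by every \<open>F\<close>-linear functional, hence is \<open>0\<close>.
  Uniqueness of the factorization is also a consequence of the condition on the span.
\<close>

locale differentials = vector_space scale
  for scale :: "'f::field \<Rightarrow> 'w::ab_group_add \<Rightarrow> 'w" +
  fixes \<iota> :: "'k::field \<Rightarrow> 'f" and d :: "'f \<Rightarrow> 'w"
  assumes d_add: "d (a + b) = d a + d b"
    and d_mult: "d (a * b) = scale a (d b) + scale b (d a)"
    and d_const: "d (\<iota> c) = 0"
    and d_span: "span (range d) = UNIV"
    and d_universal: "derivation \<iota> D \<Longrightarrow> \<exists>l. Vector_Spaces.linear scale (*) l \<and> (\<forall>a. l (d a) = D a)"

text \<open>
  The description is independent of the choice of \<open>\<phi>\<close> and \<open>\<eta>\<close>, since exact forms and forms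
  \<open>\<eta>\<^sup>p x\<^sup>p\<^sup>-\<^sup>1 dx\<close> only have \<open>0\<close> in common and the Frobenius map is injective.
\<close>

definition modified_cartier ::
  "('k::field \<Rightarrow> 'f::field) \<Rightarrow> ('f \<Rightarrow> 'w::ab_group_add \<Rightarrow> 'w) \<Rightarrow> ('f \<Rightarrow> 'w) \<Rightarrow> nat \<Rightarrow> 'f \<Rightarrow> 'f \<Rightarrow> 'w \<Rightarrow> 'w"
where
  "modified_cartier \<iota> scale d p x y \<omega> =
     (THE \<theta>. \<exists>\<phi> \<eta>. \<eta> ^ p \<in> field_adjoin \<iota> {x ^ p, y ^ p} \<and>
        \<omega> = d \<phi> + scale (\<eta> ^ p * x ^ (p - 1)) (d x) \<and> \<theta> = scale \<eta> (d x))"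


section \<open>Curves as sets of local rings\<close>

text \<open>
  A closed point of an integral curve with function field \<open>F\<close> is represented by its local
  ring, a subring of \<open>F\<close>. The curve being separated, distinct points have distinct local rings.
\<close>

definition nonunits :: "'f::field set \<Rightarrow> 'f set" where
  "nonunits R = {a \<in> R. a = 0 \<or> inverse a \<notin> R}"

text \<open>Closed points of the nonsingular projective curve \<open>X\<close>: the valuation rings of \<open>F/K\<close>.\<close>

definition places :: "('k::field \<Rightarrow> 'f::field) \<Rightarrow> 'f set set" where
  "places \<iota> = {Q. subring Q type_ring \<and> range \<iota> \<subseteq> Q \<and> Q \<noteq> UNIV \<and> (\<forall>z. z \<in> Q \<or> inverse z \<in> Q)}"

text \<open>
  The birational morphism from \<open>X\<close> to a complete curve sends \<open>Q\<close> to the unique point whose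
  local ring is dominated by \<open>Q\<close>.
\<close>

definition lies_over :: "'f::field set \<Rightarrow> 'f set \<Rightarrow> bool" where
  "lies_over Q P \<longleftrightarrow> P \<subseteq> Q \<and> nonunits P = nonunits Q \<inter> P"

definition localization_at :: "'f::field set \<Rightarrow> 'f set \<Rightarrow> 'f set" where
  "localization_at R M = {a / b | a b. a \<in> R \<and> b \<in> R - M}"

text \<open>
  Let \<open>z = [z\<^sub>0, \<dots>, z\<^sub>n]\<close> be homogeneous coordinates in \<open>F\<close> of a generic point of an integral closed
  subscheme of projective \<open>n\<close>-space over \<open>K\<close>. Its intersection with the standard open set of index
  \<open>i\<close>, which is nonempty iff \<open>z\<^sub>i \<noteq> 0\<close>, is the spectrum of \<open>K[z\<^sub>0/z\<^sub>i, \<dots>, z\<^sub>n/z\<^sub>i]\<close>.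
\<close>

definition chart :: "('k::field \<Rightarrow> 'f::field) \<Rightarrow> 'f list \<Rightarrow> nat \<Rightarrow> 'f set" where
  "chart \<iota> z i = ring_adjoin \<iota> {z ! j / z ! i | j. j < length z}"

definition chart_points :: "('k::field \<Rightarrow> 'f::field) \<Rightarrow> 'f list \<Rightarrow> nat \<Rightarrow> 'f set set" where
  "chart_points \<iota> z i =
     {localization_at (chart \<iota> z i) M | M. maximalideal M (on_subring (chart \<iota> z i))}"

definition proj_points :: "('k::field \<Rightarrow> 'f::field) \<Rightarrow> 'f list \<Rightarrow> 'f set set" where
  "proj_points \<iota> z = (\<Union>i \<in> {i. i < length z \<and> z ! i \<noteq> 0}. chart_points \<iota> z i)"

text \<open>The point all of whose homogeneous coordinates except the one of index \<open>i\<close> vanish.\<close>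

definition vertex :: "('k::field \<Rightarrow> 'f::field) \<Rightarrow> 'f list \<Rightarrow> nat \<Rightarrow> 'f set" where
  "vertex \<iota> z i =
     localization_at (chart \<iota> z i)
       (genideal (on_subring (chart \<iota> z i)) {z ! j / z ! i | j. j < length z \<and> j \<noteq> i})"

definition curve_C :: "('k::field \<Rightarrow> 'f::field) \<Rightarrow> 'f \<Rightarrow> 'f \<Rightarrow> 'f set set" where
  "curve_C \<iota> x y = proj_points \<iota> [1, x, y]"

definition affine_zeros_y :: "('k::field \<Rightarrow> 'f::field) \<Rightarrow> 'f \<Rightarrow> 'f \<Rightarrow> 'f set set" where
  "affine_zeros_y \<iota> x y = {P \<in> chart_points \<iota> [1, x, y] 0. y \<in> nonunits P}"

text \<open>
  In the next two definitions \<open>n\<close> is the degree of \<open>f\<close>. The points at infinity are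
  \<open>(0 : 1 : 0)\<close> and \<open>(0 : 0 : 1)\<close>. Gluing two curves with function field \<open>F\<close> along
  their common open subset amounts to the union of the two sets of local rings.
\<close>

definition point_at_infinity :: "('k::field \<Rightarrow> 'f::field) \<Rightarrow> nat \<Rightarrow> nat \<Rightarrow> 'f \<Rightarrow> 'f \<Rightarrow> 'f set" where
  "point_at_infinity \<iota> N n x y = (if N > n then vertex \<iota> [1, x, y] 1 else vertex \<iota> [1, x, y] 2)"

definition curve_C_tilde :: "('k::field \<Rightarrow> 'f::field) \<Rightarrow> nat \<Rightarrow> nat \<Rightarrow> 'f \<Rightarrow> 'f \<Rightarrow> 'f set set" where
  "curve_C_tilde \<iota> N n x y =
     (if N = n then curve_C \<iota> x y
      else (curve_C \<iota> x y - {point_at_infinity \<iota> N n x y}) \<union>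
           {Q \<in> places \<iota>. \<exists>P \<in> curve_C \<iota> x y - affine_zeros_y \<iota> x y. lies_over Q P})"


section \<open>Residues\<close>

definition ac_scale :: "'k::field \<Rightarrow> 'k alg_closure \<Rightarrow> 'k alg_closure" where
  "ac_scale c a = to_ac c * a"

lemma vector_space_ac_scale: "vector_space ac_scale"
  by unfold_locales (simp_all add: ac_scale_def algebra_simps)

text \<open>
  For \<open>L\<close> a finite extension of \<open>K\<close> inside the algebraic closure: the trace of
  the \<open>K\<close>-linear endomorphism of \<open>L\<close> given by multiplication with \<open>a\<close>.
\<close>

definition field_trace :: "'k::field alg_closure set \<Rightarrow> 'k alg_closure \<Rightarrow> 'k" where
  "field_trace L a =
     (let B = (SOME B. \<not> module.dependent ac_scale B \<and> module.span ac_scale B = L)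
      in \<Sum>b\<in>B. module.representation ac_scale B (a * b) b)"

text \<open>
  An embedding of \<open>F\<close> into the Laurent series over the algebraic closure
  of \<open>K\<close> that identifies the completion of \<open>F\<close> at \<open>Q\<close> with \<open>L((t))\<close>, where \<open>t\<close> is a
  uniformizer at \<open>Q\<close> and \<open>L\<close>, the set of constant terms of elements of \<open>Q\<close>, is
  a copy of the residue field.
\<close>

definition local_expansion ::
  "('k::field \<Rightarrow> 'f::field) \<Rightarrow> 'f set \<Rightarrow> 'f \<Rightarrow> ('f \<Rightarrow> 'k alg_closure fls) \<Rightarrow> bool" where
  "local_expansion \<iota> Q t \<sigma> \<longleftrightarrow>
     \<sigma> \<in> ring_hom type_ring type_ring \<and>
     (\<forall>c. \<sigma> (\<iota> c) = fls_const (to_ac c)) \<and>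
     Q = {z. fls_subdegree (\<sigma> z) \<ge> 0} \<and>
     \<sigma> t = fls_X"

definition constant_terms :: "'f set \<Rightarrow> ('f \<Rightarrow> 'k::field alg_closure fls) \<Rightarrow> 'k alg_closure set" where
  "constant_terms Q \<sigma> = {fls_nth (\<sigma> z) 0 | z. z \<in> Q}"

text \<open>
  The residue of \<open>\<omega> = g dt\<close> with values in \<open>K\<close>: the trace from the residue field to \<open>K\<close> of
  the coefficient of \<open>t\<^sup>-\<^sup>1\<close> in \<open>g\<close>. For \<open>K\<close> perfect an expansion exists at every place, so
  the value \<open>0\<close> in the second case is a dummy, and the
  result depends neither on the uniformizer nor on the embedding.
\<close>

definition residue_at ::
  "('k::field \<Rightarrow> 'f::field) \<Rightarrow> ('f \<Rightarrow> 'w \<Rightarrow> 'w) \<Rightarrow> ('f \<Rightarrow> 'w) \<Rightarrow> 'f set \<Rightarrow> 'w \<Rightarrow> 'k" where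
  "residue_at \<iota> scale d Q \<omega> =
     (if \<exists>t \<sigma>. local_expansion \<iota> Q t \<sigma> then
        (let (t, \<sigma>) = (SOME (t, \<sigma>). local_expansion \<iota> Q t \<sigma>);
             g = (THE g. \<omega> = scale g (d t))
         in field_trace (constant_terms Q \<sigma>) (fls_residue (\<sigma> g)))
      else 0)"


section \<open>Regular differential forms in the sense of Serre\<close>

definition Omega_at ::
  "('k::field \<Rightarrow> 'f::field) \<Rightarrow> ('f \<Rightarrow> 'w \<Rightarrow> 'w) \<Rightarrow> ('f \<Rightarrow> 'w) \<Rightarrow> 'f set \<Rightarrow> 'w set" where
  "Omega_at \<iota> scale d P =
     {\<omega>. \<forall>h\<in>P. (\<Sum>Q | Q \<in> places \<iota> \<and> lies_over Q P. residue_at \<iota> scale d Q (scale h \<omega>)) = 0}"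

definition Omega ::
  "('k::field \<Rightarrow> 'f::field) \<Rightarrow> ('f \<Rightarrow> 'w \<Rightarrow> 'w) \<Rightarrow> ('f \<Rightarrow> 'w) \<Rightarrow> 'f set set \<Rightarrow> 'w set" where
  "Omega \<iota> scale d Y = (\<Inter>P\<in>Y. Omega_at \<iota> scale d P)"

end

theory Submission
  imports Defs
begin

text \<open>
  As \<open>K\<close> is perfect and \<open>p\<close> does not divide \<open>N\<close>, \<open>F = F\<^sup>p[x]\<close>; hence every form is
  \<open>\<omega> = d\<phi> + \<eta>\<^sup>p x\<^sup>p\<^sup>-\<^sup>1 dx\<close>, and \<open>h C'(\<omega>) = C'(h\<^sup>p \<omega>)\<close>. At each place \<open>res(C'(\<omega>))\<^sup>p = res(\<omega>)\<close>:
  \<open>x\<close> may be replaced by the expansion parameter \<open>t\<close> modulo exact forms, residues of exact forms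
  vanish, and the trace of the residue field commutes with Frobenius. If \<open>\<omega>\<close> lies in \<open>\<Omega>[C]\<^sub>P\<close> and
  \<open>h\<close> in the local ring at \<open>P\<close>, the sum of the residues of \<open>h C'(\<omega>)\<close> over \<open>P\<close> therefore has as \<open>p\<close>-th
  power the sum for \<open>h\<^sup>p \<omega>\<close>, which is \<open>0\<close> because \<open>h\<^sup>p\<close> is in the local ring too.
\<close>

section \<open>Sums of \<open>p\<close>-th powers times powers of \<open>x\<close>\<close>

text \<open>This is F^p[x]: exponents below \<open>p\<close> suffice because x^p is itself a p-th
  power.\<close>

definition frobenius_span :: "nat \<Rightarrow> 'f::field \<Rightarrow> 'f set" where
  "frobenius_span p x = range (\<lambda>c. \<Sum>i<p. c i ^ p * x ^ i)"

context
  fixes p :: nat and x :: "'f::field"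
  assumes char: "CHAR('f) = p" and pos: "p > 0"
begin

lemma prime_char: "prime p"
  using prime_CHAR_semidom[where 'a = 'f] char pos by simp

lemma power_p_add: "(a + b :: 'f) ^ p = a ^ p + b ^ p"
  using prime_char char by (intro freshmans_dream) auto

lemma frobenius_span_add:
  assumes "a \<in> frobenius_span p x" "b \<in> frobenius_span p x"
  shows "a + b \<in> frobenius_span p x"
proof -
  obtain c e where "a = (\<Sum>i<p. c i ^ p * x ^ i)" "b = (\<Sum>i<p. e i ^ p * x ^ i)"
    using assms by (auto simp: frobenius_span_def)
  then have "a + b = (\<Sum>i<p. (c i + e i) ^ p * x ^ i)"
    by (simp add: power_p_add sum.distrib algebra_simps)
  then show ?thesis
    unfolding frobenius_span_def by (rule range_eqI[where x = "\<lambda>i. c i + e i"])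
qed

text \<open>Division of \<open>n\<close> by \<open>p\<close> with remainder: the power of x^p is
  absorbed into the p-th power coefficient.\<close>

lemma frobenius_span_monomial: "a ^ p * x ^ n \<in> frobenius_span p x"
proof -
  have "a ^ p * x ^ n = (a * x ^ (n div p)) ^ p * x ^ (n mod p)"
    by (simp add: power_mult_distrib flip: power_mult power_add)
  also have "\<dots> = (\<Sum>i<p. (if i = n mod p then a * x ^ (n div p) else 0) ^ p * x ^ i)"
    using pos by (subst sum.remove[of _ "n mod p"]) (auto intro!: sum.neutral)
  finally show ?thesis
    unfolding frobenius_span_def by (rule range_eqI[where x = "\<lambda>i. if i = n mod p then a * x ^ (n div p) else 0"])
qed

lemma frobenius_span_sum:
  assumes "\<And>i. i \<in> I \<Longrightarrow> g i \<in> frobenius_span p x"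
  shows "sum g I \<in> frobenius_span p x"
  using assms frobenius_span_monomial[of 0 0] pos
  by (induction I rule: infinite_finite_induct) (auto intro: frobenius_span_add simp: zero_power)

lemma frobenius_span_mult:
  assumes "a \<in> frobenius_span p x" "b \<in> frobenius_span p x"
  shows "a * b \<in> frobenius_span p x"
proof -
  obtain c e where "a = (\<Sum>i<p. c i ^ p * x ^ i)" "b = (\<Sum>i<p. e i ^ p * x ^ i)"
    using assms by (auto simp: frobenius_span_def)
  then have "a * b = (\<Sum>i<p. \<Sum>j<p. (c i * e j) ^ p * x ^ (i + j))"
    by (simp add: sum_product power_mult_distrib power_add algebra_simps)
  then show ?thesis
    by (auto intro!: frobenius_span_sum frobenius_span_monomial)
qed

lemma frobenius_span_power_p: "a ^ p \<in> frobenius_span p x"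
  using frobenius_span_monomial[of a 0] by simp

lemma frobenius_span_power:
  "a \<in> frobenius_span p x \<Longrightarrow> a ^ n \<in> frobenius_span p x"
  using frobenius_span_power_p[of 1] by (induction n) (auto intro: frobenius_span_mult)

lemma frobenius_span_uminus:
  assumes "a \<in> frobenius_span p x"
  shows "- a \<in> frobenius_span p x"
proof -
  have "(- 1 :: 'f) ^ p = - 1"
    using minus_power_prime_CHAR[of p "1::'f"] prime_char char by simp
  then show ?thesis
    using frobenius_span_mult[OF frobenius_span_power_p[of "- 1"] assms] by simp
qed

text \<open>Dividing by the p-th power a^p suffices: 1/a = (1/a)^p a^(p-1). With inverse 0 = 0 this
  also holds at 0. So F^p[x] is a field.\<close>

lemma frobenius_span_inverse:
  assumes "a \<in> frobenius_span p x"
  shows "inverse a \<in> frobenius_span p x"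
proof -
  have "inverse a = inverse a ^ p * a ^ (p - 1)"
    using pos by (cases p) (auto simp: field_simps)
  then show ?thesis
    using frobenius_span_mult[OF frobenius_span_power_p frobenius_span_power[OF assms]] by metis
qed

text \<open>Bezout for \<open>N\<close> and \<open>p\<close>: \<open>b = (b\<^sup>N)\<^sup>u (b\<^sup>v)\<^sup>-\<^sup>p\<close> where \<open>N u = p v + 1\<close>.\<close>

lemma frobenius_span_root:
  assumes "b ^ N \<in> frobenius_span p x" "\<not> p dvd N"
  shows "b \<in> frobenius_span p x"
proof (cases "b = 0")
  case True
  then show ?thesis
    using frobenius_span_power_p[of 0] pos by (simp add: zero_power)
next
  case False
  have "coprime N p"
    using prime_char assms(2) by (metis coprime_commute prime_imp_coprime)
  moreover have "N \<noteq> 0"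
    using assms(2) by (metis dvd_0_right)
  ultimately obtain u v where uv: "N * u = p * v + 1"
    using bezout_nat[of N p] by auto
  have "b * (b ^ v) ^ p = (b ^ N) ^ u"
    using uv by (simp flip: power_mult power_Suc add: mult.commute)
  then have "b = (b ^ N) ^ u * inverse (b ^ v) ^ p"
    using False by (simp add: field_simps)
  then show ?thesis
    using frobenius_span_mult[OF frobenius_span_power[OF assms(1)] frobenius_span_power_p] by metis
qed

end

section \<open>Dictionary between HOL-Algebra and the type class operations; field
  homomorphisms\<close>

lemma type_ring_simps [simp]:
  "carrier type_ring = UNIV" "a \<otimes>\<^bsub>type_ring\<^esub> b = a * b" "a \<oplus>\<^bsub>type_ring\<^esub> b = a + b"
  "\<one>\<^bsub>type_ring\<^esub> = 1" "\<zero>\<^bsub>type_ring\<^esub> = 0"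
  by (simp_all add: ring_of_type_algebra_def)

lemma type_ring_a_inv [simp]: "\<ominus>\<^bsub>type_ring\<^esub> (a :: 'a::comm_ring_1) = - a"
proof -
  interpret ring "type_ring :: 'a ring"
    by (rule ring_from_type_algebra)
  show ?thesis
    using minus_equality[of "- a" a] by simp
qed

lemma type_ring_m_inv:
  assumes "(a :: 'a::field) \<noteq> 0"
  shows "inv\<^bsub>type_ring\<^esub> a = inverse a"
proof -
  interpret cring "type_ring :: 'a ring"
    by (rule cring_from_type_algebra)
  show ?thesis
    using comm_inv_char[of a "inverse a"] assms by simp
qed

lemma type_ring_homD:
  assumes "h \<in> ring_hom type_ring type_ring"
  shows "h (a * b) = h a * h b" "h (a + b) = h a + h b" "h 1 = 1"
  using ring_hom_mult[OF assms] ring_hom_add[OF assms] ring_hom_one[OF assms] by simp_all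

lemma type_ring_hom_0:
  assumes "(h :: 'a::comm_ring_1 \<Rightarrow> 'b::comm_ring_1) \<in> ring_hom type_ring type_ring"
  shows "h 0 = 0"
  using type_ring_homD(2)[OF assms, of 0 0] by simp

lemma type_ring_hom_power:
  assumes "(h :: 'a::comm_ring_1 \<Rightarrow> 'b::comm_ring_1) \<in> ring_hom type_ring type_ring"
  shows "h (a ^ n) = h a ^ n"
  by (induction n) (simp_all add: type_ring_homD[OF assms])

lemma type_ring_hom_of_nat:
  assumes "(h :: 'a::comm_ring_1 \<Rightarrow> 'b::comm_ring_1) \<in> ring_hom type_ring type_ring"
  shows "h (of_nat n) = of_nat n"
  by (induction n) (simp_all add: type_ring_homD[OF assms] type_ring_hom_0[OF assms])

lemma type_ring_hom_inverse:
  assumes "(h :: 'a::field \<Rightarrow> 'b::field) \<in> ring_hom type_ring type_ring"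
  shows "h (inverse a) = inverse (h a)"
proof (cases "a = 0")
  case False
  then have "h a * h (inverse a) = 1"
    by (simp add: type_ring_homD(3)[OF assms] flip: type_ring_homD(1)[OF assms])
  then show ?thesis
    by (metis inverse_unique)
qed (simp add: type_ring_hom_0[OF assms])

lemma type_ring_hom_CHAR:
  assumes "(h :: 'a::field \<Rightarrow> 'b::field) \<in> ring_hom type_ring type_ring"
  shows "CHAR('b) = CHAR('a)"
proof (rule CHAR_eqI)
  show "of_nat CHAR('a) = (0 :: 'b)"
    using type_ring_hom_of_nat[OF assms, of "CHAR('a)"] type_ring_hom_0[OF assms] by simp
next
  fix n assume "of_nat n = (0 :: 'b)"
  then have "h (of_nat n) = 0"
    by (simp add: type_ring_hom_of_nat[OF assms])
  then have "of_nat n = (0 :: 'a)"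
    using type_ring_hom_inverse[OF assms, of "of_nat n"] type_ring_homD(1,3)[OF assms]
    by (metis mult_zero_left right_inverse zero_neq_one)
  then show "CHAR('a) dvd n"
    by (simp add: of_nat_eq_0_iff_char_dvd)
qed

lemma field_adjoin_subset:
  fixes S :: "'f::field set"
  assumes "range \<iota> \<union> S \<subseteq> W" "1 \<in> W" "\<And>a. a \<in> W \<Longrightarrow> - a \<in> W" "\<And>a. a \<in> W \<Longrightarrow> inverse a \<in> W"
    "\<And>a b. a \<in> W \<Longrightarrow> b \<in> W \<Longrightarrow> a + b \<in> W" "\<And>a b. a \<in> W \<Longrightarrow> b \<in> W \<Longrightarrow> a * b \<in> W"
  shows "field_adjoin \<iota> S \<subseteq> W"
proof
  fix a assume "a \<in> field_adjoin \<iota> S"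
  then show "a \<in> W"
    unfolding field_adjoin_def
    by (induction rule: generate_field.induct) (use assms in \<open>auto simp: type_ring_m_inv\<close>)
qed

lemma perfect_field_root:
  fixes c :: "'k::field"
  assumes "perfect_field TYPE('k)" "CHAR('k) = p" "p > 0"
  shows "\<exists>b. c = b ^ p"
  using assms unfolding perfect_field_def surj_def by auto

text \<open>Constants are p-th powers since K is perfect, so y^N = f(x) lies in F^p[x], and the
  Bezout argument puts \<open>y\<close> there. A subfield containing K, \<open>x\<close> and
  \<open>y\<close> is everything.\<close>

lemma function_field_frobenius_span:
  fixes \<iota> :: "'k::field \<Rightarrow> 'f::field"
  assumes "CHAR('k) = p" "p > 0" "perfect_field TYPE('k)" "\<not> p dvd N"
    and "is_function_field \<iota> N f x y"
  shows "CHAR('f) = p" "frobenius_span p x = UNIV"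
proof -
  have hom: "\<iota> \<in> ring_hom type_ring type_ring" and y: "y ^ N = poly (map_poly \<iota> f) x"
    and adj: "field_adjoin \<iota> {x, y} = UNIV"
    using assms(5) by (auto simp: is_function_field_def)
  show char: "CHAR('f) = p"
    using type_ring_hom_CHAR[OF hom] assms(1) by simp
  note closed = frobenius_span_add[OF char assms(2)] frobenius_span_mult[OF char assms(2)]
    frobenius_span_uminus[OF char assms(2)] frobenius_span_inverse[OF char assms(2)]
  have one: "1 \<in> frobenius_span p x"
    using frobenius_span_power_p[OF char assms(2), of 1] by simp
  have const: "\<iota> c \<in> frobenius_span p x" for c
  proof -
    obtain b where "c = b ^ p"
      using perfect_field_root[OF assms(3,1,2)] by blast
    then show ?thesis
      using frobenius_span_power_p[OF char assms(2)] by (simp add: type_ring_hom_power[OF hom])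
  qed
  have x: "x \<in> frobenius_span p x"
    using frobenius_span_monomial[OF char assms(2), of 1 x 1] by simp
  have "poly q x \<in> frobenius_span p x" if "\<And>i. coeff q i \<in> frobenius_span p x" for q
    unfolding poly_altdef
    by (intro frobenius_span_sum[OF char assms(2)] closed frobenius_span_power[OF char assms(2)] that x)
  then have "y ^ N \<in> frobenius_span p x"
    using const by (simp add: y coeff_map_poly type_ring_hom_0[OF hom])
  then have "y \<in> frobenius_span p x"
    using frobenius_span_root[OF char assms(2)] assms(4) by blast
  then have "field_adjoin \<iota> {x, y} \<subseteq> frobenius_span p x"
    by (intro field_adjoin_subset) (use one x const closed in auto)
  then show "frobenius_span p x = UNIV"
    using adj by auto
qed

section \<open>The derivation with respect to \<open>x\<close>\<close>

lemma sum_atLeast_1_lessThan: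
  fixes g :: "nat \<Rightarrow> 'a::ab_group_add"
  assumes "0 < n"
  shows "(\<Sum>k\<in>{1..<n}. g k) = (\<Sum>k<n. g k) - g 0"
  using assms by (subst (2) sum.remove[of _ 0]) (auto intro!: sum.cong)

locale frobenius_basis =
  fixes p :: nat and x :: "'a::field"
  assumes char: "CHAR('a) = p" and pos: "p > 0" and span: "frobenius_span p x = UNIV"
begin

text \<open>Reduces additive statements about F to monomials; the empty sum counts as the monomial
  with \<open>c\<close> and \<open>n\<close> zero.\<close>

lemma frobenius_induct:
  assumes "\<And>c n. n < p \<Longrightarrow> P (c ^ p * x ^ n)" "\<And>a b. P a \<Longrightarrow> P b \<Longrightarrow> P (a + b)"
  shows "P a"
proof -
  obtain c where "a = (\<Sum>i<p. c i ^ p * x ^ i)"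
    using span unfolding frobenius_span_def by blast
  moreover have "P (\<Sum>i\<in>I. c i ^ p * x ^ i)" if "finite I" "I \<subseteq> {..<p}" for I
    using that
  proof (induction rule: finite_induct)
    case empty
    then show ?case
      using assms(1)[of 0 0] pos by (simp add: zero_power)
  qed (use assms in auto)
  ultimately show ?thesis
    by auto
qed

end

text \<open>\<open>D\<close> is d/dx; below it is instantiated with the coefficient of
  \<open>d a\<close> along \<open>d x\<close>. The rules determine it, as p-th powers are killed and
  generate F together with \<open>x\<close>.\<close>

locale derivation_wrt = frobenius_basis p x for p :: nat and x :: "'a::field" +
  fixes D :: "'a \<Rightarrow> 'a"
  assumes D_add: "D (a + b) = D a + D b" and D_mult: "D (a * b) = a * D b + b * D a"
    and D_x: "D x = 1"
begin

lemma D_0: "D 0 = 0"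
  using D_add[of 0 0] by (metis add.right_neutral add_left_cancel)

lemma D_uminus: "D (- a) = - D a"
  using D_add[of a "- a"] by (simp add: D_0 eq_neg_iff_add_eq_0 add.commute)

lemma D_diff: "D (a - b) = D a - D b"
  using D_add[of a "- b"] by (simp add: D_uminus)

lemma D_1: "D 1 = 0"
  using D_mult[of 1 1] by (metis add.right_neutral add_left_cancel mult_1)

lemma D_sum: "D (sum g I) = (\<Sum>i\<in>I. D (g i))"
  by (induction I rule: infinite_finite_induct) (simp_all add: D_0 D_add)

lemma D_of_nat: "D (of_nat n) = 0"
  by (induction n) (simp_all add: D_0 D_1 D_add)

lemma D_power: "D (a ^ n) = of_nat n * a ^ (n - 1) * D a"
proof (induction n)
  case (Suc n)
  then show ?case
    by (cases n) (simp_all add: D_mult algebra_simps)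
qed (simp add: D_1)

lemma of_nat_p: "of_nat p = (0 :: 'a)"
  using char of_nat_CHAR by metis

lemma D_power_p: "D (a ^ p) = 0"
  by (simp add: D_power of_nat_p)

lemma D_power_p_mult: "D (a ^ p * b) = a ^ p * D b"
  by (simp add: D_mult D_power_p)

text \<open>Fermat's little theorem in the prime field, from additivity of Frobenius.\<close>

lemma of_nat_power_p: "of_nat n ^ p = (of_nat n :: 'a)"
  using pos by (induction n) (simp_all add: power_p_add[OF char pos] zero_power)

lemma funpow_D_const_mult_power:
  assumes "D c = 0"
  shows "(D ^^ n) (c * x ^ n) = c * of_nat (fact n)"
  using assms
proof (induction n arbitrary: c)
  case (Suc n)
  have "D (c * x ^ Suc n) = c * of_nat (Suc n) * x ^ n"
    using Suc.prems by (simp add: D_mult D_x D_power algebra_simps del: power_Suc of_nat_Suc)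
  then have "(D ^^ Suc n) (c * x ^ Suc n) = (D ^^ n) (c * of_nat (Suc n) * x ^ n)"
    by (simp only: funpow_Suc_right comp_apply)
  also have "\<dots> = c * of_nat (Suc n) * of_nat (fact n)"
    using Suc.prems by (intro Suc.IH) (simp add: D_mult D_of_nat del: of_nat_Suc)
  finally show ?case
    by (simp add: algebra_simps)
qed simp

lemma funpow_D_0: "(D ^^ n) 0 = 0"
  by (induction n) (simp_all add: D_0)

lemma funpow_D_add: "(D ^^ n) (a + b) = (D ^^ n) a + (D ^^ n) b"
  by (induction n) (simp_all add: D_add)

text \<open>For n < p, a monomial c^p x^n already dies after n + 1 derivatives.\<close>

lemma funpow_D_p: "(D ^^ p) a = 0"
proof (induction a rule: frobenius_induct)
  case (1 c n)
  have "(D ^^ Suc n) (c ^ p * x ^ n) = D (c ^ p * of_nat (fact n))"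
    by (simp add: funpow_D_const_mult_power D_power_p)
  also have "\<dots> = 0"
    by (simp add: D_mult D_power_p D_of_nat)
  finally have "(D ^^ (p - Suc n)) ((D ^^ Suc n) (c ^ p * x ^ n)) = 0"
    by (simp only: funpow_D_0)
  moreover have "p - Suc n + Suc n = p"
    using 1 by simp
  ultimately show ?case
    by (metis funpow_add comp_apply)
qed (simp add: funpow_D_add)

lemma of_nat_fact_neq_0: "of_nat (fact (p - 1)) \<noteq> (0 :: 'a)"
proof -
  have "\<not> p dvd fact (p - 1)"
    using prime_char[OF char pos] pos by (simp add: prime_dvd_fact_iff)
  then show ?thesis
    using of_nat_eq_0_iff_char_dvd[where 'a = 'a, of "fact (p - 1)"] char by simp
qed

text \<open>Differentiating p - 1 more times gives 0 on the left and (p-1)! \<eta>^p on the right.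
  This is what makes the modified Cartier operator well defined.\<close>

lemma D_eq_power_p_times_imp_0:
  assumes "D \<phi> = \<eta> ^ p * x ^ (p - 1)"
  shows "\<eta> = 0"
proof -
  have "(D ^^ p) \<phi> = (D ^^ (p - 1)) (D \<phi>)"
    using pos by (metis Suc_pred' comp_apply funpow_Suc_right)
  then have "\<eta> ^ p * of_nat (fact (p - 1)) = 0"
    using assms funpow_D_p by (simp add: funpow_D_const_mult_power D_power_p)
  then show ?thesis
    using of_nat_fact_neq_0 by simp
qed

text \<open>For n < p - 1 the monomial x^n has the primitive x^(n+1)/(n+1), and p-th power
  coefficients pass through \<open>D\<close>. Only x^(p-1) contributes to \<eta>.\<close>

lemma exact_plus_cartier_decomposition:
  obtains \<phi> \<eta> where "g = D \<phi> + \<eta> ^ p * x ^ (p - 1)"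
proof -
  have "\<exists>\<phi> \<eta>. g = D \<phi> + \<eta> ^ p * x ^ (p - 1)"
  proof (induction g rule: frobenius_induct)
    case (1 c n)
    show ?case
    proof (cases "n = p - 1")
      case True
      then show ?thesis
        by (intro exI[of _ 0] exI[of _ c]) (simp add: D_0)
    next
      case False
      have "\<not> p dvd Suc n"
        using False 1 by (auto dest: dvd_imp_le)
      then have "of_nat (Suc n) \<noteq> (0 :: 'a)"
        using of_nat_eq_0_iff_char_dvd[where 'a = 'a, of "Suc n"] char by simp
      \<comment> \<open>By Fermat, 1/(n+1) is its own p-th power, hence a constant for
        \<open>D\<close>.\<close>
      moreover have "D (inverse (of_nat (Suc n))) = 0"
        by (metis D_of_nat D_power_p of_nat_power_p power_inverse)
      ultimately have "c ^ p * x ^ n = D (c ^ p * (inverse (of_nat (Suc n)) * x ^ Suc n))"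
        unfolding D_power_p_mult by (simp add: D_mult D_power D_x del: of_nat_Suc power_Suc)
      then show ?thesis
        using pos by (intro exI[of _ "c ^ p * (inverse (of_nat (Suc n)) * x ^ Suc n)"] exI[of _ 0])
          (simp add: zero_power)
    qed
  next
    case (2 a b)
    then obtain \<phi> \<eta> \<phi>' \<eta>' where
      "a = D \<phi> + \<eta> ^ p * x ^ (p - 1)" "b = D \<phi>' + \<eta>' ^ p * x ^ (p - 1)"
      by blast
    then have "a + b = D (\<phi> + \<phi>') + (\<eta> + \<eta>') ^ p * x ^ (p - 1)"
      by (simp add: D_add power_p_add[OF char pos] algebra_simps)
    then show ?case
      by blast
  qed
  then show thesis
    using that by blast
qed

text \<open>The primitive is \<open>((u + v)\<^sup>p - u\<^sup>p - v\<^sup>p) / p\<close>, the division being carried out over the integers.\<close>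

lemma power_times_D_additive_mod_exact:
  "(u + v) ^ (p - 1) * D (u + v) - u ^ (p - 1) * D u - v ^ (p - 1) * D v \<in> range D"
proof -
  define e where "e k = ((p choose k) div p)" for k
  define \<psi> where "\<psi> = (\<Sum>k\<in>{1..<p}. of_nat (e k) * (u ^ k * v ^ (p - k)))"
  \<comment> \<open>The absorption identities for binomial coefficients, with the factor
    \<open>p\<close> cancelled among natural numbers, where it is nonzero.\<close>
  have e: "k * e k = (p - 1) choose (k - 1)" "(p - k) * e k = (p - 1) choose k"
    if "k \<in> {1..<p}" for k
  proof -
    have "p dvd (p choose k)"
      using that prime_char[OF char pos] by (intro dvd_choose_prime) auto
    then have ek: "p * e k = p choose k"
      by (simp add: e_def)
    have "p * (k * e k) = p * ((p - 1) choose (k - 1))"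
      using ek times_binomial_minus1_eq[of k p] that by (simp add: algebra_simps)
    then show "k * e k = (p - 1) choose (k - 1)"
      using pos by simp
    have "p * ((p - k) * e k) = p * ((p - 1) choose k)"
      using ek binomial_absorb_comp[of p k] by (simp add: algebra_simps)
    then show "(p - k) * e k = (p - 1) choose k"
      using pos by simp
  qed
  have binom: "(u + v) ^ (p - 1) = (\<Sum>k<p. of_nat ((p - 1) choose k) * u ^ k * v ^ (p - 1 - k))"
  proof -
    have "{..p - 1} = {..<p}"
      using pos by auto
    then show ?thesis
      using binomial_ring[of u v "p - 1"] by simp
  qed
  have "D \<psi> = (\<Sum>k\<in>{1..<p}. of_nat (k * e k) * u ^ (k - 1) * v ^ (p - k) * D u
              + of_nat ((p - k) * e k) * u ^ k * v ^ (p - 1 - k) * D v)"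
    unfolding \<psi>_def D_sum
    by (intro sum.cong refl) (simp add: D_mult D_power D_of_nat algebra_simps)
  also have "\<dots> = (\<Sum>k\<in>{1..<p}. of_nat ((p - 1) choose (k - 1)) * u ^ (k - 1) * v ^ (p - k)) * D u
              + (\<Sum>k\<in>{1..<p}. of_nat ((p - 1) choose k) * u ^ k * v ^ (p - 1 - k)) * D v"
    by (simp add: e sum.distrib sum_distrib_right del: of_nat_mult)
  \<comment> \<open>Each of the two sums is the expansion of (u+v)^(p-1) with one end term missing:
    v^(p-1) beside \<open>D v\<close> and, after the shift of \<open>k\<close>, u^(p-1) beside
    \<open>D u\<close>.\<close>
  also have "(\<Sum>k\<in>{1..<p}. of_nat ((p - 1) choose k) * u ^ k * v ^ (p - 1 - k))
    = (u + v) ^ (p - 1) - v ^ (p - 1)"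
    using sum_atLeast_1_lessThan[OF pos, of "\<lambda>k. of_nat ((p - 1) choose k) * u ^ k * v ^ (p - 1 - k)"]
    unfolding binom by simp
  also have "(\<Sum>k\<in>{1..<p}. of_nat ((p - 1) choose (k - 1)) * u ^ (k - 1) * v ^ (p - k))
    = (\<Sum>k<p - 1. of_nat ((p - 1) choose k) * u ^ k * v ^ (p - 1 - k))"
    by (rule sum.reindex_bij_witness[of _ Suc "\<lambda>k. k - 1"]) auto
  also have "\<dots> = (u + v) ^ (p - 1) - u ^ (p - 1)"
    using binom pos by (cases p) simp_all
  finally have "D \<psi> = (u + v) ^ (p - 1) * D (u + v) - u ^ (p - 1) * D u - v ^ (p - 1) * D v"
    by (simp add: D_add algebra_simps)
  then show ?thesis
    by (metis rangeI)
qed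

text \<open>Modulo exact forms, \<open>u\<^sup>p\<^sup>-\<^sup>1 du\<close> equals \<open>(du/dx)\<^sup>p x\<^sup>p\<^sup>-\<^sup>1 dx\<close>: the Cartier operator maps
  \<open>u\<^sup>p\<^sup>-\<^sup>1 du\<close> to \<open>du\<close> for every \<open>u\<close>, so it does not depend on the choice of \<open>x\<close>.\<close>

lemma power_times_D_cartier:
  obtains \<psi> where "u ^ (p - 1) * D u = D u ^ p * x ^ (p - 1) + D \<psi>"
proof -
  have "\<exists>\<psi>. u ^ (p - 1) * D u = D u ^ p * x ^ (p - 1) + D \<psi>"
  proof (induction u rule: frobenius_induct)
    case (1 c n)
    have D: "D (c ^ p * x ^ n) = of_nat n * c ^ p * x ^ (n - 1)"
      by (simp add: D_power_p_mult D_power D_x)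
    \<comment> \<open>On monomials the identity is exact, with \<psi> = 0; the integer coefficients
      match because n^p = n in F.\<close>
    have "(c ^ p * x ^ n) ^ (p - 1) * D (c ^ p * x ^ n) = D (c ^ p * x ^ n) ^ p * x ^ (p - 1)"
    proof (cases n)
      case 0
      then show ?thesis
        using pos by (simp add: D_power_p zero_power)
    next
      case (Suc m)
      obtain q where q: "p = Suc q"
        using pos by (cases p) auto
      have "(c ^ p * x ^ n) ^ (p - 1) * D (c ^ p * x ^ n)
          = of_nat n * ((c ^ p) ^ q * c ^ p) * ((x ^ n) ^ q * x ^ m)"
        unfolding D by (simp add: Suc q power_mult_distrib algebra_simps)
      also have "(c ^ p) ^ q * c ^ p = (c ^ p) ^ p"
        by (simp add: q mult.commute)
      also have "(x ^ n) ^ q * x ^ m = (x ^ m) ^ p * x ^ q"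
        by (simp add: Suc q algebra_simps flip: power_mult power_add)
      also have "of_nat n * (c ^ p) ^ p * ((x ^ m) ^ p * x ^ q) = D (c ^ p * x ^ n) ^ p * x ^ (p - 1)"
        unfolding D power_mult_distrib of_nat_power_p by (simp add: Suc q)
      finally show ?thesis .
    qed
    then show ?case
      by (intro exI[of _ 0]) (simp add: D_0)
  next
    case (2 u v)
    then obtain \<psi> \<psi>' where
      "u ^ (p - 1) * D u = D u ^ p * x ^ (p - 1) + D \<psi>"
      "v ^ (p - 1) * D v = D v ^ p * x ^ (p - 1) + D \<psi>'"
      by blast
    \<comment> \<open>The right side is additive in \<open>u\<close> modulo exact terms; \<rho>
      accounts for the left side being so too.\<close>
    moreover obtain \<rho> where
      "D \<rho> = (u + v) ^ (p - 1) * D (u + v) - u ^ (p - 1) * D u - v ^ (p - 1) * D v"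
      using power_times_D_additive_mod_exact[of u v] by (metis rangeE)
    ultimately have
      "(u + v) ^ (p - 1) * D (u + v) = D (u + v) ^ p * x ^ (p - 1) + D (\<psi> + \<psi>' + \<rho>)"
      unfolding D_add power_p_add[OF char pos] by (simp add: algebra_simps)
    then show ?case
      by blast
  qed
  then show thesis
    using that by blast
qed

end

section \<open>Frobenius on residues and traces\<close>

text \<open>Frobenius is additive, so the p-th power of a series has the terms (a_i)^p t^(p i). Only
  the finitely many terms up to index \<open>n\<close> matter, and they are split off from the
  lowest on; \<open>k\<close> counts them.\<close>

lemma fls_nth_power_CHAR:
  includes fps_syntax
  fixes f :: "'a::field fls"
  assumes "CHAR('a) = p" "p > 0"
  shows "(f ^ p) $$ (int p * n) = (f $$ n) ^ p"
proof -
  have "(g ^ p) $$ (int p * n) = (g $$ n) ^ p" if "\<And>i. i < n + 1 - int k \<Longrightarrow> g $$ i = 0" for g :: "'a fls" and k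
    using that
  proof (induction k arbitrary: g)
    case 0
    show ?case
    proof (cases "g = 0")
      case False
      then have "n + 1 \<le> fls_subdegree g"
        using 0 by (intro fls_subdegree_geI) auto
      then have "int p * n < fls_subdegree (g ^ p)"
        using assms(2) by (simp add: fls_subdegree_pow)
      then show ?thesis
        using 0 assms(2) by (simp add: zero_power)
    qed (use assms(2) in \<open>simp add: zero_power\<close>)
  next
    case (Suc k)
    \<comment> \<open>The lowest index at which \<open>g\<close> may be nonzero; removing this term
      leaves \<open>k\<close> candidates.\<close>
    define m where "m = n - int k"
    define c where "c = g $$ m"
    define h where "h = g - fls_const c * fls_X_intpow m"
    have h: "h $$ i = (if i = m then 0 else g $$ i)" for i
      by (simp add: h_def c_def)
    have "(h ^ p) $$ (int p * n) = (h $$ n) ^ p"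
      using Suc.prems by (intro Suc.IH) (auto simp: h m_def)
    moreover have "g ^ p = (fls_const c * fls_X_intpow m) ^ p + h ^ p"
      using assms by (subst power_p_add[symmetric]) (simp_all add: h_def)
    moreover have "(fls_const c * fls_X_intpow m) ^ p = fls_const (c ^ p) * fls_X_intpow (int p * m)"
      by (simp add: power_mult_distrib fls_const_power fls_X_intpow_power mult.commute)
    ultimately show ?case
      using assms(2) by (auto simp: h c_def zero_power)
  qed
  \<comment> \<open>If the order of \<open>f\<close> is at most n + 1, this \<open>k\<close> makes
    the bound n + 1 - k equal to that order; otherwise \<open>k\<close> is 0.\<close>
  from this[where k = "nat (n + 1 - fls_subdegree f)" and g = f] show ?thesis
    by (cases "n + 1 < fls_subdegree f") auto
qed

text \<open>The factor t^(p-1) moves the coefficient of index -p = p * (-1) in f^p to index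
  -1.\<close>

lemma fls_residue_power_CHAR:
  includes fps_syntax
  fixes f :: "'a::field fls"
  assumes "CHAR('a) = p" "p > 0"
  shows "fls_residue (f ^ p * fls_X ^ (p - 1)) = fls_residue f ^ p"
proof -
  have "fls_residue (f ^ p * fls_X ^ (p - 1)) = (f ^ p) $$ (int p * - 1)"
    using assms(2) by (simp add: fls_X_power_times_conv_shift of_nat_diff)
  then show ?thesis
    using fls_nth_power_CHAR[OF assms, of f "- 1"] by simp
qed

lemma fls_deriv_power_CHAR:
  fixes f :: "'a::field fls"
  assumes "CHAR('a) = p"
  shows "fls_deriv (f ^ p) = 0"
  using assms by (simp add: fls_deriv_power) (metis of_nat_CHAR semiring_char_fls)

section \<open>Traces do not depend on the basis\<close>

context vector_space
begin

lemma representation_sum_scale: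
  assumes "independent B" "finite B" "b \<in> B"
  shows "representation B (\<Sum>c\<in>B. f c *s c) b = f b"
proof -
  have "representation B (\<Sum>c\<in>B. f c *s c) b = (\<Sum>c\<in>B. representation B (f c *s c) b)"
    using assms by (subst representation_sum) (auto intro: span_scale span_base)
  also have "\<dots> = (\<Sum>c\<in>B. if b = c then f c else 0)"
    using assms by (intro sum.cong refl) (auto simp: representation_scale span_base representation_basis)
  also have "\<dots> = f b"
    using assms by simp
  finally show ?thesis .
qed

text \<open>This is tr(ST) = tr(TS): both traces equal one double sum of products of the entries of
  \<open>T\<close> from \<open>B\<close> to \<open>B'\<close> and of the change of basis from
  \<open>B'\<close> to \<open>B\<close>.\<close>

lemma trace_basis_independent:
  assumes B: "independent B" "finite B" and B': "independent B'" "finite B'"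
    and span: "span B = span B'"
    and T: "\<And>v w. T (v + w) = T v + T w" "\<And>c v. T (c *s v) = c *s T v"
    and T_span: "\<And>v. v \<in> span B \<Longrightarrow> T v \<in> span B"
  shows "(\<Sum>b\<in>B. representation B (T b) b) = (\<Sum>b\<in>B'. representation B' (T b) b)"
proof -
  have T_0: "T 0 = 0"
    using T(1)[of 0 0] by simp
  have T_sum: "T (sum g I) = (\<Sum>i\<in>I. T (g i))" for g :: "'b \<Rightarrow> 'b" and I
    by (induction I rule: infinite_finite_induct) (simp_all add: T T_0)
  have in_span: "v \<in> span B" if "v \<in> B \<or> v \<in> B'" for v
    using that span by (auto intro: span_base)
  have expand: "v = (\<Sum>b\<in>B. representation B v b *s b)" if "v \<in> span B" for v
    using sum_representation_eq[OF B(1) that B(2) order.refl] by simp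
  have T_rep: "representation B' (T v) b' = (\<Sum>b\<in>B. representation B v b * representation B' (T b) b')"
    if "v \<in> span B" for v b'
  proof -
    have "T v = (\<Sum>b\<in>B. representation B v b *s T b)"
      by (subst expand[OF that]) (simp add: T_sum T)
    then show ?thesis
      using B'(1) T_span in_span span
      by (simp add: representation_sum representation_scale span_scale)
  qed
  have comp: "representation B v b = (\<Sum>b'\<in>B'. representation B' v b' * representation B b' b)"
    if "v \<in> span B" for v b
  proof -
    have "v = (\<Sum>b'\<in>B'. representation B' v b' *s b')"
      using sum_representation_eq[OF B'(1) _ B'(2) order.refl] that span by simp
    then have "representation B v b = representation B (\<Sum>b'\<in>B'. representation B' v b' *s b') b"
      by simp
    then show ?thesis
      using B(1) in_span by (simp add: representation_sum representation_scale span_scale)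
  qed
  have "(\<Sum>b'\<in>B'. representation B' (T b') b')
      = (\<Sum>b'\<in>B'. \<Sum>b\<in>B. representation B' (T b) b' * representation B b' b)"
    using in_span by (intro sum.cong refl) (simp add: T_rep mult.commute)
  also have "\<dots> = (\<Sum>b\<in>B. \<Sum>b'\<in>B'. representation B' (T b) b' * representation B b' b)"
    by (rule sum.swap)
  also have "\<dots> = (\<Sum>b\<in>B. representation B (T b) b)"
    using in_span T_span by (intro sum.cong refl) (simp add: comp)
  finally show ?thesis ..
qed

end

interpretation ac: vector_space ac_scale
  by (rule vector_space_ac_scale)

text \<open>Replaces the basis picked by \<open>SOME\<close> in \<open>field_trace\<close>, which is
  finite by the exchange bound, with any given finite one.\<close>

lemma field_trace_eq:
  fixes L :: "'k::field alg_closure set"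
  assumes B: "ac.independent B" "ac.span B = L" "finite B" and L: "\<And>b. b \<in> L \<Longrightarrow> a * b \<in> L"
  shows "field_trace L a = (\<Sum>b\<in>B. ac.representation B (a * b) b)"
proof -
  define B' where "B' = (SOME B. ac.independent B \<and> ac.span B = L)"
  have B': "ac.independent B'" "ac.span B' = L"
    using someI[of "\<lambda>B. ac.independent B \<and> ac.span B = L", OF conjI[OF B(1,2)]]
    by (simp_all add: B'_def)
  then have "finite B'"
    using ac.independent_span_bound[OF B(3) B'(1)] B(2) ac.span_superset by blast
  then have "(\<Sum>b\<in>B'. ac.representation B' (a * b) b) = (\<Sum>b\<in>B. ac.representation B (a * b) b)"
    using B B' L by (intro ac.trace_basis_independent) (auto simp: ac_scale_def algebra_simps)
  then show ?thesis
    by (simp add: field_trace_def B'_def[symmetric] Let_def)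
qed

section \<open>Frobenius commutes with the trace over a perfect field\<close>

locale subfield_over_perfect =
  fixes p :: nat and L :: "'k::field alg_closure set"
  assumes char: "CHAR('k) = p" and pos: "p > 0" and perfect: "perfect_field TYPE('k)"
    and L_add: "a \<in> L \<Longrightarrow> b \<in> L \<Longrightarrow> a + b \<in> L" and L_mult: "a \<in> L \<Longrightarrow> b \<in> L \<Longrightarrow> a * b \<in> L"
    and L_inverse: "a \<in> L \<Longrightarrow> inverse a \<in> L" and L_const: "to_ac c \<in> L"
begin

lemma ex_power_p_root: "\<exists>g. \<forall>v. f v = (g v :: 'k) ^ p"
  using perfect_field_root[OF perfect char pos] by (intro choice allI)

lemma subspace_L: "ac.subspace L"
  unfolding ac.subspace_def
  using L_const[of 0] L_add L_mult L_const by (auto simp: ac_scale_def)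

lemma L_power: "a \<in> L \<Longrightarrow> a ^ n \<in> L"
  using L_const[of 1] L_mult by (induction n) auto

lemma power_p_inj: "inj (\<lambda>a :: 'k alg_closure. a ^ p)"
proof (rule injI)
  fix a b :: "'k alg_closure" assume "a ^ p = b ^ p"
  moreover have "(a - b + b) ^ p = (a - b) ^ p + b ^ p"
    using char pos by (intro power_p_add) simp_all
  ultimately show "a = b"
    by simp
qed

lemma power_p_sum: "(\<Sum>i\<in>I. g i :: 'k alg_closure) ^ p = (\<Sum>i\<in>I. g i ^ p)"
  using prime_char[where 'f = 'k, OF char pos] char by (intro freshmans_dream_sum) simp_all

text \<open>Since \<open>K\<close> is perfect, the Frobenius map takes a finite basis to another one.\<close>

lemma independent_power_p:
  fixes B :: "'k alg_closure set"
  assumes "ac.independent B" "finite B"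
  shows "ac.independent ((\<lambda>b. b ^ p) ` B)"
proof (rule ac.independent_if_scalars_zero)
  have inj: "inj_on (\<lambda>b. b ^ p) B"
    using inj_on_subset[OF power_p_inj subset_UNIV] .
  fix f :: "'k alg_closure \<Rightarrow> 'k" and v
  assume sum: "(\<Sum>v\<in>(\<lambda>b. b ^ p) ` B. ac_scale (f v) v) = 0" and v: "v \<in> (\<lambda>b. b ^ p) ` B"
  obtain g where g: "f v = g v ^ p" for v
    using ex_power_p_root by blast
  have "(\<Sum>b\<in>B. ac_scale (g (b ^ p)) b) ^ p = 0"
    using sum by (simp add: sum.reindex[OF inj] power_p_sum ac_scale_def g power_mult_distrib)
  then have "(\<Sum>b\<in>B. ac_scale (g (b ^ p)) b) = 0"
    by simp
  then have "g (b ^ p) = 0" if "b \<in> B" for b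
    using ac.independentD[OF assms order.refl, of "\<lambda>b. g (b ^ p)"] that by blast
  then show "f v = 0"
    using v pos by (auto simp: g zero_power)
qed (use assms in simp)

text \<open>Dimension count: the p-th powers of \<open>B\<close> are card B independent elements of
  \<open>L\<close>, so adding one from outside their span would exceed the dimension.\<close>

lemma span_power_p:
  fixes B :: "'k alg_closure set"
  assumes "ac.independent B" "finite B" "ac.span B = L"
  shows "ac.span ((\<lambda>b. b ^ p) ` B) = L"
proof
  have sub: "(\<lambda>b. b ^ p) ` B \<subseteq> L"
    using assms(3) ac.span_superset L_power by auto
  then show "ac.span ((\<lambda>b. b ^ p) ` B) \<subseteq> L"
    using subspace_L by (rule ac.span_minimal)
  show "L \<subseteq> ac.span ((\<lambda>b. b ^ p) ` B)"
  proof
    fix a assume a: "a \<in> L"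
    show "a \<in> ac.span ((\<lambda>b. b ^ p) ` B)"
    proof (rule ccontr)
      assume na: "a \<notin> ac.span ((\<lambda>b. b ^ p) ` B)"
      then have "ac.independent (insert a ((\<lambda>b. b ^ p) ` B))"
        using independent_power_p[OF assms(1,2)] by (simp add: ac.independent_insert)
      moreover have "insert a ((\<lambda>b. b ^ p) ` B) \<subseteq> ac.span B"
        using a sub assms(3) by simp
      ultimately have "card (insert a ((\<lambda>b. b ^ p) ` B)) \<le> card B"
        using ac.independent_span_bound[OF assms(2)] by blast
      moreover have "a \<notin> (\<lambda>b. b ^ p) ` B"
        using na ac.span_base by metis
      ultimately show False
        using assms(2) card_image[OF inj_on_subset[OF power_p_inj subset_UNIV], of B] by simp
    qed
  qed
qed

text \<open>Expand a^p in the basis of p-th powers and take p-th roots of the coefficients in K;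
  injectivity of Frobenius recovers \<open>a\<close>. Thus \<open>L\<close> is perfect.\<close>

lemma power_p_mem_iff:
  fixes B :: "'k alg_closure set"
  assumes "ac.independent B" "finite B" "ac.span B = L"
  shows "a ^ p \<in> L \<longleftrightarrow> a \<in> L"
proof
  assume "a ^ p \<in> L"
  then have "a ^ p \<in> ac.span ((\<lambda>b. b ^ p) ` B)"
    using span_power_p[OF assms] by simp
  then obtain f where "a ^ p = (\<Sum>v\<in>(\<lambda>b. b ^ p) ` B. ac_scale (f v) v)"
    using assms(2) by (auto simp: ac.span_finite)
  moreover obtain g where g: "f v = g v ^ p" for v
    using ex_power_p_root by blast
  ultimately have "a ^ p = (\<Sum>b\<in>B. ac_scale (f (b ^ p)) (b ^ p))"
    using sum.reindex[OF inj_on_subset[OF power_p_inj subset_UNIV], of _ B] by simp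
  also have "\<dots> = (\<Sum>b\<in>B. ac_scale (g (b ^ p)) b) ^ p"
    by (simp only: power_p_sum ac_scale_def power_mult_distrib g to_ac_power)
  finally have "a = (\<Sum>b\<in>B. ac_scale (g (b ^ p)) b)"
    by (rule injD[OF power_p_inj])
  also have "\<dots> \<in> ac.span B"
    by (intro ac.span_sum ac.span_scale ac.span_base)
  finally show "a \<in> L"
    using assms(3) by simp
qed (rule L_power)

text \<open>In the basis of p-th powers, multiplication by a^p has as matrix entries the p-th powers
  of those of \<open>a\<close> in \<open>B\<close>. If \<open>B\<close> is infinite, or
  \<open>a\<close> is outside \<open>L\<close>, both sides take the default value 0.\<close>

lemma field_trace_power_p: "field_trace L (a ^ p) = field_trace L a ^ p"
proof -
  define B where "B = (SOME B. ac.independent B \<and> ac.span B = L)"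
  have trace: "field_trace L a = (\<Sum>b\<in>B. ac.representation B (a * b) b)" for a
    by (simp add: field_trace_def B_def Let_def)
  have "\<exists>B. ac.independent B \<and> ac.span B = L"
    using ac.basis_exists[of L] ac.span_minimal[OF _ subspace_L] by (metis subset_antisym)
  then have B: "ac.independent B" "ac.span B = L"
    unfolding B_def by (metis (mono_tags, lifting) someI_ex)+
  show ?thesis
  proof (cases "finite B")
    case False
    then show ?thesis
      using pos by (simp add: trace zero_power)
  next
    case fin: True
    have inj: "inj_on (\<lambda>b. b ^ p) B"
      using inj_on_subset[OF power_p_inj subset_UNIV] .
    note indep = independent_power_p[OF B(1) fin]
    show ?thesis
    proof (cases "a \<in> L")
      case True
      have "field_trace L (a ^ p)
          = (\<Sum>b\<in>B. ac.representation ((\<lambda>b. b ^ p) ` B) (a ^ p * b ^ p) (b ^ p))"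
        using field_trace_eq[OF indep span_power_p[OF B(1) fin B(2)] finite_imageI[OF fin], of "a ^ p"]
          L_mult[OF L_power[OF True]] by (simp only: sum.reindex[OF inj] comp_def)
      also have "\<dots> = (\<Sum>b\<in>B. ac.representation B (a * b) b ^ p)"
      proof (rule sum.cong[OF refl])
        fix b assume b: "b \<in> B"
        define r where "r = ac.representation B (a * b)"
        \<comment> \<open>The coordinate at b^p is the p-th power of the coordinate at b.\<close>
        define f where "f v = r (the_inv_into B (\<lambda>b. b ^ p) v) ^ p" for v
        have "a * b \<in> ac.span B"
          using True b B L_mult ac.span_base by blast
        then have "a * b = (\<Sum>c\<in>B. ac_scale (r c) c)"
          using ac.sum_representation_eq[OF B(1) _ fin order.refl] by (simp add: r_def)
        then have "a ^ p * b ^ p = (\<Sum>c\<in>B. ac_scale (r c) c) ^ p"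
          by (metis power_mult_distrib)
        also have "\<dots> = (\<Sum>v\<in>(\<lambda>b. b ^ p) ` B. ac_scale (f v) v)"
          unfolding sum.reindex[OF inj] power_p_sum comp_def
          by (intro sum.cong refl)
            (simp add: f_def the_inv_into_f_f[OF inj] ac_scale_def power_mult_distrib)
        finally have "ac.representation ((\<lambda>b. b ^ p) ` B) (a ^ p * b ^ p) (b ^ p) = f (b ^ p)"
          using ac.representation_sum_scale[OF indep] fin b by simp
        then show "ac.representation ((\<lambda>b. b ^ p) ` B) (a ^ p * b ^ p) (b ^ p)
            = ac.representation B (a * b) b ^ p"
          using b by (simp add: f_def r_def the_inv_into_f_f[OF inj])
      qed
      also have "\<dots> = field_trace L a ^ p"
        unfolding trace using prime_char[where 'f = 'k, OF char pos] char
        by (intro freshmans_dream_sum[symmetric]) simp_all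
      finally show ?thesis .
    next
      case False
      \<comment> \<open>Multiplication by \<open>c\<close> moves every basis vector out of
        \<open>L\<close>, where \<open>representation\<close> is 0 by convention.\<close>
      have "field_trace L c = 0" if "c \<notin> L" for c
      proof -
        have "c * b \<notin> L" if "b \<in> B" for b
        proof
          assume "c * b \<in> L"
          moreover have "b \<noteq> 0" "b \<in> L"
            using that B ac.dependent_zero ac.span_base by blast+
          ultimately have "c * b * inverse b \<in> L"
            using L_mult L_inverse by blast
          then show False
            using \<open>b \<noteq> 0\<close> \<open>c \<notin> L\<close> by (simp add: mult.assoc)
        qed
        then show ?thesis
          using B(2) by (simp add: trace ac.representation_def)
      qed
      then show ?thesis
        using False power_p_mem_iff[OF B(1) fin B(2)] pos by (simp add: zero_power)
    qed
  qed
qed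

end

section \<open>Residues and the modified Cartier operator\<close>

context differentials
begin

lemma d_1: "d 1 = 0"
  using d_mult[of 1 1] by simp

lemma d_power: "d (a ^ n) = scale (of_nat n * a ^ (n - 1)) (d a)"
proof (induction n)
  case (Suc n)
  then show ?case
    by (cases n) (simp_all add: d_mult algebra_simps flip: scale_left_distrib)
qed (simp add: d_1)

lemma d_frobenius_basis:
  assumes "frobenius_basis p x"
  shows "\<exists>g. d a = scale g (d x)"
proof -
  interpret frobenius_basis p x
    by fact
  show ?thesis
  proof (induction a rule: frobenius_induct)
    case (1 c n)
    have "of_nat p = (0 :: 'f)"
      using char of_nat_CHAR by metis
    then have "d (c ^ p) = 0"
      by (simp add: d_power)
    then have "d (c ^ p * x ^ n) = scale (c ^ p * (of_nat n * x ^ (n - 1))) (d x)"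
      unfolding d_mult d_power[of x] by simp
    then show ?case
      by blast
  next
    case (2 a b)
    then show ?case
      by (metis d_add scale_left_distrib)
  qed
qed

text \<open>Every \<open>d a\<close> lies on the line through \<open>d x\<close>, and these elements
  span all forms.\<close>

lemma ex_scale_dx:
  assumes "frobenius_basis p x"
  shows "\<exists>g. \<omega> = scale g (d x)"
proof -
  have "range d \<subseteq> span {d x}"
    using d_frobenius_basis[OF assms] by (auto simp: span_singleton)
  then have "span (range d) \<subseteq> span {d x}"
    by (intro span_minimal) auto
  then show ?thesis
    using d_span by (auto simp: span_singleton)
qed

end

section \<open>Closure properties of adjoined fields\<close>

lemma field_adjoin_base: "a \<in> range \<iota> \<union> S \<Longrightarrow> a \<in> field_adjoin \<iota> S"
  unfolding field_adjoin_def by (rule generate_field.incl)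

lemma field_adjoin_1: "1 \<in> field_adjoin \<iota> S"
  using generate_field.one[of type_ring] by (simp add: field_adjoin_def)

lemma field_adjoin_uminus: "a \<in> field_adjoin \<iota> S \<Longrightarrow> - a \<in> field_adjoin \<iota> S"
  using generate_field.a_inv[of a type_ring] by (simp add: field_adjoin_def)

lemma field_adjoin_add:
  "a \<in> field_adjoin \<iota> S \<Longrightarrow> b \<in> field_adjoin \<iota> S \<Longrightarrow> a + b \<in> field_adjoin \<iota> S"
  using generate_field.eng_add[of a type_ring _ b] by (simp add: field_adjoin_def)

lemma field_adjoin_mult:
  "a \<in> field_adjoin \<iota> S \<Longrightarrow> b \<in> field_adjoin \<iota> S \<Longrightarrow> a * b \<in> field_adjoin \<iota> S"
  using generate_field.eng_mult[of a type_ring _ b] by (simp add: field_adjoin_def)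

lemma field_adjoin_inverse:
  assumes "a \<in> field_adjoin \<iota> S"
  shows "inverse a \<in> field_adjoin \<iota> S"
  using assms generate_field.m_inv[of a type_ring]
  by (cases "a = 0") (simp_all add: field_adjoin_def type_ring_m_inv)

text \<open>The elements whose p-th power lies in K(x^p, y^p) form a field containing K,
  \<open>x\<close> and \<open>y\<close>. Hence the membership condition in
  \<open>modified_cartier\<close> always holds.\<close>

lemma power_p_mem_field_adjoin:
  fixes \<iota> :: "'k::field \<Rightarrow> 'f::field"
  assumes hom: "\<iota> \<in> ring_hom type_ring type_ring" and char: "CHAR('f) = p" "p > 0"
    and adj: "field_adjoin \<iota> {x, y} = UNIV"
  shows "\<eta> ^ p \<in> field_adjoin \<iota> {x ^ p, y ^ p}"
proof -
  have uminus: "(- a) ^ p = - (a ^ p)" for a :: 'f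
    using prime_char[OF char] char by (simp add: minus_power_prime_CHAR)
  have "\<iota> c ^ p \<in> field_adjoin \<iota> {x ^ p, y ^ p}" for c
    by (intro field_adjoin_base) (simp flip: type_ring_hom_power[OF hom])
  moreover have "x ^ p \<in> field_adjoin \<iota> {x ^ p, y ^ p}" "y ^ p \<in> field_adjoin \<iota> {x ^ p, y ^ p}"
    by (intro field_adjoin_base; simp)+
  ultimately have "field_adjoin \<iota> {x, y} \<subseteq> {a. a ^ p \<in> field_adjoin \<iota> {x ^ p, y ^ p}}"
    by (intro field_adjoin_subset)
      (auto simp: uminus power_p_add[OF char] power_mult_distrib power_inverse field_adjoin_1
        field_adjoin_uminus field_adjoin_inverse field_adjoin_add field_adjoin_mult)
  then show ?thesis
    using adj by auto
qed

section \<open>Forms as multiples of dx\<close>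

locale differentials_wrt = differentials scale \<iota> d + derivation_wrt p x D
  for scale :: "'f::field \<Rightarrow> 'w::ab_group_add \<Rightarrow> 'w" and \<iota> :: "'k::field \<Rightarrow> 'f" and d :: "'f \<Rightarrow> 'w"
    and p :: nat and x :: 'f and D :: "'f \<Rightarrow> 'f" +
  fixes y :: 'f
  assumes d_eq: "d a = scale (D a) (d x)" and dx: "d x \<noteq> 0"
    and hom: "\<iota> \<in> ring_hom type_ring type_ring" and adj: "field_adjoin \<iota> {x, y} = UNIV"
    and perfect: "perfect_field TYPE('k)"
begin

lemma char_K: "CHAR('k) = p"
  using type_ring_hom_CHAR[OF hom] char by simp

lemma ex_cartier_decomposition: "\<exists>\<phi> \<eta>. \<omega> = scale (D \<phi> + \<eta> ^ p * x ^ (p - 1)) (d x)"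
  using ex_scale_dx[OF frobenius_basis_axioms, of \<omega>] exact_plus_cartier_decomposition by metis

text \<open>Evaluates the \<open>THE\<close>: two decompositions of one form differ by an equation
  D(\<phi> - \<phi>') = (\<eta>' - \<eta>)^p x^(p-1), which forces \<eta> = \<eta>'.\<close>

lemma modified_cartier_eq:
  "modified_cartier \<iota> scale d p x y (scale (D \<phi> + \<eta> ^ p * x ^ (p - 1)) (d x)) = scale \<eta> (d x)"
  unfolding modified_cartier_def
proof (rule the_equality)
  show "\<exists>\<phi>' \<eta>'. \<eta>' ^ p \<in> field_adjoin \<iota> {x ^ p, y ^ p} \<and>
      scale (D \<phi> + \<eta> ^ p * x ^ (p - 1)) (d x) = d \<phi>' + scale (\<eta>' ^ p * x ^ (p - 1)) (d x) \<and>
      scale \<eta> (d x) = scale \<eta>' (d x)"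
    using power_p_mem_field_adjoin[OF hom char pos adj]
    by (intro exI[of _ \<phi>] exI[of _ \<eta>]) (simp add: d_eq[of \<phi>] scale_left_distrib)
next
  fix \<theta>
  assume "\<exists>\<phi>' \<eta>'. \<eta>' ^ p \<in> field_adjoin \<iota> {x ^ p, y ^ p} \<and>
      scale (D \<phi> + \<eta> ^ p * x ^ (p - 1)) (d x) = d \<phi>' + scale (\<eta>' ^ p * x ^ (p - 1)) (d x) \<and>
      \<theta> = scale \<eta>' (d x)"
  then obtain \<phi>' \<eta>' where
    eq: "scale (D \<phi> + \<eta> ^ p * x ^ (p - 1)) (d x) = scale (D \<phi>' + \<eta>' ^ p * x ^ (p - 1)) (d x)"
    and \<theta>: "\<theta> = scale \<eta>' (d x)"
    by (metis d_eq scale_left_distrib)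
  have "D (\<phi> - \<phi>') = (\<eta>' ^ p - \<eta> ^ p) * x ^ (p - 1)"
    using scale_right_imp_eq[OF dx eq] by (simp add: D_diff algebra_simps)
  moreover have "\<eta>' ^ p - \<eta> ^ p = (\<eta>' - \<eta>) ^ p"
    using power_p_add[OF char pos, of "\<eta>' - \<eta>" \<eta>] by simp
  ultimately show "\<theta> = scale \<eta> (d x)"
    using D_eq_power_p_times_imp_0[of "\<phi> - \<phi>'" "\<eta>' - \<eta>"] \<theta> by simp
qed

lemma subfield_constant_terms:
  assumes "local_expansion \<iota> Q t \<sigma>"
  shows "subfield_over_perfect p (constant_terms Q \<sigma>)"
proof -
  have \<sigma>: "\<sigma> \<in> ring_hom type_ring type_ring" and const: "\<sigma> (\<iota> c) = fls_const (to_ac c)"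
    and Q: "z \<in> Q \<longleftrightarrow> fls_subdegree (\<sigma> z) \<ge> 0" for c z
    using assms by (auto simp: local_expansion_def)
  have memI: "fls_nth (\<sigma> z) 0 \<in> constant_terms Q \<sigma>" if "z \<in> Q" for z
    using that by (auto simp: constant_terms_def)
  have mult: "fls_nth (\<sigma> (z * w)) 0 = fls_nth (\<sigma> z) 0 * fls_nth (\<sigma> w) 0"
    if "z \<in> Q" "w \<in> Q" for z w
  proof -
    \<comment> \<open>Without negative exponents the product is one of power series, whose constant
      terms multiply.\<close>
    have "\<sigma> (z * w) = fps_to_fls (fls_regpart (\<sigma> z) * fls_regpart (\<sigma> w))"
      using that by (simp add: Q type_ring_homD[OF \<sigma>] fls_times_fps_to_fls)
    then show ?thesis
      by simp
  qed
  show ?thesis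
  proof
    fix a b assume "a \<in> constant_terms Q \<sigma>" "b \<in> constant_terms Q \<sigma>"
    then obtain z w where a: "a = fls_nth (\<sigma> z) 0" "z \<in> Q" and b: "b = fls_nth (\<sigma> w) 0" "w \<in> Q"
      by (auto simp: constant_terms_def)
    \<comment> \<open>The zero series is separated because the lower bound on the order of a sum
      fails for it; its order is 0 by convention.\<close>
    have "z + w \<in> Q"
      using a b by (cases "\<sigma> z + \<sigma> w = 0")
        (auto simp: Q type_ring_homD[OF \<sigma>] intro: fls_plus_subdegree order.trans[rotated])
    then show "a + b \<in> constant_terms Q \<sigma>"
      using memI[of "z + w"] a b by (simp add: type_ring_homD[OF \<sigma>])
    have zw: "z * w \<in> Q"
      using a b by (cases "\<sigma> z = 0 \<or> \<sigma> w = 0") (auto simp: Q type_ring_homD[OF \<sigma>])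
    show "a * b \<in> constant_terms Q \<sigma>"
      using memI[OF zw] a b by (simp add: mult)
  next
    fix a assume "a \<in> constant_terms Q \<sigma>"
    then obtain z where a: "a = fls_nth (\<sigma> z) 0" and z: "z \<in> Q"
      by (auto simp: constant_terms_def)
    show "inverse a \<in> constant_terms Q \<sigma>"
    proof (cases "a = 0")
      case False
      \<comment> \<open>A nonzero constant term means order exactly 0, so \<open>z\<close> is a unit
        of \<open>Q\<close>.\<close>
      then have deg: "fls_subdegree (\<sigma> z) = 0" and "z \<noteq> 0"
        using z fls_subdegree_leI[of "\<sigma> z" 0] type_ring_hom_0[OF \<sigma>] by (auto simp: a Q)
      then have inv: "inverse z \<in> Q"
        by (simp add: Q type_ring_hom_inverse[OF \<sigma>])
      have "a * fls_nth (\<sigma> (inverse z)) 0 = 1"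
        using mult[OF z inv] \<open>z \<noteq> 0\<close> type_ring_homD(3)[OF \<sigma>] by (simp add: a)
      then show ?thesis
        using memI[OF inv] inverse_unique by metis
    qed (use \<open>a \<in> _\<close> in simp)
  next
    fix c
    have "\<iota> c \<in> Q"
      by (simp add: Q const)
    then show "to_ac c \<in> constant_terms Q \<sigma>"
      using memI[of "\<iota> c"] by (simp add: const)
  qed (use char_K pos perfect in auto)
qed

text \<open>Chain rule: on monomials c^p x^n, and so on all of F, the derivative of \<sigma>(a) is
  \<sigma>(D a) times that of \<sigma>(x). Taking a = t, which expands to the variable, shows that
  this last factor is inverse to \<sigma>(D t).\<close>

lemma local_expansion_deriv:
  assumes "local_expansion \<iota> Q t \<sigma>"
  shows "D t \<noteq> 0" "fls_deriv (\<sigma> a) = \<sigma> (D a / D t)"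
proof -
  have \<sigma>: "\<sigma> \<in> ring_hom type_ring type_ring" and t: "\<sigma> t = fls_X"
    using assms by (auto simp: local_expansion_def)
  have deriv: "fls_deriv (\<sigma> a) = \<sigma> (D a) * fls_deriv (\<sigma> x)" for a
  proof (induction a rule: frobenius_induct)
    case (1 c n)
    show ?case
      using fls_deriv_power_CHAR[of p "\<sigma> c"] char_K
      by (simp add: D_power_p_mult D_power D_x type_ring_homD[OF \<sigma>] type_ring_hom_power[OF \<sigma>]
          type_ring_hom_of_nat[OF \<sigma>] fls_deriv_power[of "\<sigma> x"] algebra_simps)
  next
    case (2 a b)
    then show ?case
      by (simp add: D_add type_ring_homD[OF \<sigma>] algebra_simps)
  qed
  have Dt: "\<sigma> (D t) * fls_deriv (\<sigma> x) = 1"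
    using deriv[of t] by (simp add: t)
  then show "D t \<noteq> 0"
    using type_ring_hom_0[OF \<sigma>] by auto
  show "fls_deriv (\<sigma> a) = \<sigma> (D a / D t)"
    using Dt deriv[of a] inverse_unique[OF Dt]
    by (simp add: divide_inverse type_ring_homD[OF \<sigma>] type_ring_hom_inverse[OF \<sigma>])
qed

text \<open>As dt = D t dx is nonzero, the coefficient of a form along dt is unique. The second
  assumption names the expansion that \<open>residue_at\<close> picks; it depends on
  \<open>Q\<close> only.\<close>

lemma residue_at_eq:
  assumes "local_expansion \<iota> Q t \<sigma>" "(SOME (t, \<sigma>). local_expansion \<iota> Q t \<sigma>) = (t, \<sigma>)"
  shows "residue_at \<iota> scale d Q (scale h (d x)) =
    field_trace (constant_terms Q \<sigma>) (fls_residue (\<sigma> (h / D t)))"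
proof -
  have "(THE g. scale h (d x) = scale g (d t)) = h / D t"
    using local_expansion_deriv(1)[OF assms(1)] dx
    by (intro the_equality) (auto simp: d_eq[of t])
  moreover have "\<exists>t \<sigma>. local_expansion \<iota> Q t \<sigma>"
    using assms(1) by blast
  ultimately show ?thesis
    by (simp add: residue_at_def assms(2))
qed

lemma residue_at_cartier:
  "residue_at \<iota> scale d Q (scale (D \<phi> + \<eta> ^ p * x ^ (p - 1)) (d x)) =
    residue_at \<iota> scale d Q (scale \<eta> (d x)) ^ p"
proof (cases "\<exists>t \<sigma>. local_expansion \<iota> Q t \<sigma>")
  case False
  then show ?thesis
    using pos by (simp add: residue_at_def zero_power)
next
  case True
  obtain t \<sigma> where some: "(SOME (t, \<sigma>). local_expansion \<iota> Q t \<sigma>) = (t, \<sigma>)"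
    by (cases "SOME (t, \<sigma>). local_expansion \<iota> Q t \<sigma>")
  with True have exp: "local_expansion \<iota> Q t \<sigma>"
    using someI_ex[of "\<lambda>(t, \<sigma>). local_expansion \<iota> Q t \<sigma>"] by auto
  have \<sigma>: "\<sigma> \<in> ring_hom type_ring type_ring" and t: "\<sigma> t = fls_X"
    using exp by (auto simp: local_expansion_def)
  have Dt: "D t \<noteq> 0"
    using local_expansion_deriv(1)[OF exp] .
  interpret subfield_over_perfect p "constant_terms Q \<sigma>"
    using subfield_constant_terms[OF exp] .
  \<comment> \<open>Exchanges \<open>x\<close> for the expansion parameter \<open>t\<close> modulo
    an exact form.\<close>
  obtain \<psi> where \<psi>: "t ^ (p - 1) * D t = D t ^ p * x ^ (p - 1) + D \<psi>"
    using power_times_D_cartier .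
  \<comment> \<open>The coefficient of \<eta> dx along dt.\<close>
  define f where "f = \<eta> / D t"
  have "\<eta> ^ p * x ^ (p - 1) = f ^ p * (D t ^ p * x ^ (p - 1))"
    using Dt by (simp add: f_def power_divide)
  also have "\<dots> = f ^ p * (t ^ (p - 1) * D t) - D (f ^ p * \<psi>)"
    unfolding \<psi> D_power_p_mult by (simp add: algebra_simps)
  finally have "(D \<phi> + \<eta> ^ p * x ^ (p - 1)) / D t
      = D (\<phi> - f ^ p * \<psi>) / D t + f ^ p * t ^ (p - 1)"
    using Dt by (simp add: D_diff field_simps)
  then have "\<sigma> ((D \<phi> + \<eta> ^ p * x ^ (p - 1)) / D t)
      = fls_deriv (\<sigma> (\<phi> - f ^ p * \<psi>)) + \<sigma> f ^ p * fls_X ^ (p - 1)"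
    by (simp add: local_expansion_deriv(2)[OF exp] type_ring_homD[OF \<sigma>]
        type_ring_hom_power[OF \<sigma>] t)
  \<comment> \<open>A derivative has residue 0, so only the term f^p t^(p-1) contributes.\<close>
  then have "fls_residue (\<sigma> ((D \<phi> + \<eta> ^ p * x ^ (p - 1)) / D t)) = fls_residue (\<sigma> f) ^ p"
    using fls_residue_power_CHAR[of p "\<sigma> f"] char_K pos
    by (simp only: fls_residue_add fls_residue_deriv CHAR_alg_closure) simp
  then show ?thesis
    by (simp add: residue_at_eq[OF exp some] field_trace_power_p f_def del: fls_residue_def)
qed

lemma cartier_Omega_at:
  assumes P: "\<And>h. h \<in> P \<Longrightarrow> h ^ p \<in> P" and \<omega>: "\<omega> \<in> Omega_at \<iota> scale d P"
  shows "modified_cartier \<iota> scale d p x y \<omega> \<in> Omega_at \<iota> scale d P"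
  unfolding Omega_at_def
proof (intro CollectI ballI)
  fix h assume "h \<in> P"
  define S where "S = {Q. Q \<in> places \<iota> \<and> lies_over Q P}"
  obtain \<phi> \<eta> where dec: "\<omega> = scale (D \<phi> + \<eta> ^ p * x ^ (p - 1)) (d x)"
    using ex_cartier_decomposition by blast
  \<comment> \<open>Since \<open>D\<close> kills h^p, the factor can be taken into the exact part
    and, as \<open>h\<close>, into \<eta>.\<close>
  have "scale (h ^ p) \<omega> = scale (D (h ^ p * \<phi>) + (h * \<eta>) ^ p * x ^ (p - 1)) (d x)"
    unfolding dec D_power_p_mult power_mult_distrib scale_scale by (simp only: algebra_simps)
  then have "(\<Sum>Q\<in>S. residue_at \<iota> scale d Q (scale (h * \<eta>) (d x)) ^ p)
      = (\<Sum>Q\<in>S. residue_at \<iota> scale d Q (scale (h ^ p) \<omega>))"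
    by (simp only: residue_at_cartier)
  also have "\<dots> = 0"
    using \<omega> P[OF \<open>h \<in> P\<close>] by (simp add: Omega_at_def S_def)
  finally have "(\<Sum>Q\<in>S. residue_at \<iota> scale d Q (scale (h * \<eta>) (d x))) ^ p = 0"
    using prime_char[OF char pos] char_K by (subst freshmans_dream_sum) simp_all
  then show "(\<Sum>Q | Q \<in> places \<iota> \<and> lies_over Q P.
      residue_at \<iota> scale d Q (scale h (modified_cartier \<iota> scale d p x y \<omega>))) = 0"
    unfolding dec modified_cartier_eq scale_scale S_def using pos by simp
qed

end

lemma modified_cartier_Omega_at:
  fixes \<iota> :: "'k::field \<Rightarrow> 'f::field" and scale :: "'f \<Rightarrow> 'w::ab_group_add \<Rightarrow> 'w"
  assumes K: "CHAR('k) = p" "p > 0" "perfect_field TYPE('k)" and N: "\<not> p dvd N"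
    and F: "is_function_field \<iota> N f x y" and d: "differentials scale \<iota> d"
    and P: "\<And>h. h \<in> P \<Longrightarrow> h ^ p \<in> P" and \<omega>: "\<omega> \<in> Omega_at \<iota> scale d P"
  shows "modified_cartier \<iota> scale d p x y \<omega> \<in> Omega_at \<iota> scale d P"
proof -
  interpret differentials scale \<iota> d
    by fact
  interpret frobenius_basis p x
    by unfold_locales (use function_field_frobenius_span[OF K N F] K in auto)
  note ex_scale = ex_scale_dx[OF frobenius_basis_axioms]
  show ?thesis
  proof (cases "d x = 0")
    \<comment> \<open>This case does not occur, but it is trivial: there would be no nonzero forms.\<close>
    case True
    then have "\<theta> = 0" for \<theta> :: 'w
      using ex_scale[of \<theta>] by auto
    then show ?thesis
      using \<omega> by metis
  next
    case False
    \<comment> \<open>As \<open>d x\<close> is nonzero the coefficient is unique, so the rules for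
      \<open>d\<close> pass to \<open>D\<close>.\<close>
    define D where "D a = (SOME g. d a = scale g (d x))" for a
    have D: "d a = scale (D a) (d x)" for a
      unfolding D_def using ex_scale[of "d a"] by (rule someI_ex)
    have "scale (D (a + b)) (d x) = scale (D a + D b) (d x)"
      "scale (D (a * b)) (d x) = scale (a * D b + b * D a) (d x)"
      "scale (D x) (d x) = scale 1 (d x)" for a b
      by (simp_all add: D[symmetric] d_add d_mult scale_left_distrib flip: scale_scale)
    then have "derivation_wrt p x D"
      using False by unfold_locales (metis scale_right_imp_eq)+
    then interpret differentials_wrt scale \<iota> d p x D y
      using F unfolding is_function_field_def
      by (intro differentials_wrt.intro differentials_wrt_axioms.intro d D False K) simp_all
    show ?thesis
      using P \<omega> by (rule cartier_Omega_at)
  qed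
qed

section \<open>Local rings of the curve are closed under powers\<close>

text \<open>A maximal ideal is prime, so powers of a denominator stay outside
  \<open>M\<close>.\<close>

lemma power_mem_localization_at:
  fixes R :: "'f::field set"
  assumes R: "subring R type_ring" and M: "maximalideal M (on_subring R)"
    and h: "h \<in> localization_at R M"
  shows "h ^ n \<in> localization_at R M"
proof -
  interpret T: cring "type_ring :: 'f ring"
    by (rule cring_from_type_algebra)
  have "cring (on_subring R)"
    using T.subcring_iff[of R] T.subcringI'[OF R] by simp
  then interpret primeideal M "on_subring R"
    using M by (rule cring.maximalideal_prime)
  obtain a b where ab: "h = a / b" "a \<in> R" "b \<in> R - M"
    using h by (auto simp: localization_at_def)
  have "1 \<notin> M"
    using one_imp_carrier I_notcarr by auto
  then have "b ^ n \<in> R - M"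
    using ab(3) subringE(3,6)[OF R] I_prime by (induction n) auto
  moreover have "a ^ n \<in> R"
    using ab(2) subringE(3,6)[OF R] by (induction n) auto
  ultimately show ?thesis
    unfolding localization_at_def ab(1) power_divide by blast
qed

lemma subring_chart: "subring (chart \<iota> z i) type_ring"
  unfolding chart_def ring_adjoin_def
  by (rule ring.generate_ring_is_subring[OF ring_from_type_algebra]) simp

lemma power_mem_curve_C:
  assumes "P \<in> curve_C \<iota> x y" "h \<in> P"
  shows "h ^ n \<in> P"
  using assms power_mem_localization_at[OF subring_chart]
  by (auto simp: curve_C_def proj_points_def chart_points_def)

lemma power_mem_subring:
  fixes R :: "'f::field set"
  assumes "subring R type_ring" "h \<in> R"
  shows "h ^ n \<in> R"
  using subringE(3,6)[OF assms(1)] assms(2) by (induction n) auto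

theorem theorem6p2:
  fixes \<iota> :: "'k::field \<Rightarrow> 'f::field"
    and scale :: "'f \<Rightarrow> 'w::ab_group_add \<Rightarrow> 'w"
    and d :: "'f \<Rightarrow> 'w"
    and p N r :: nat
    and A :: "nat \<Rightarrow> nat"
    and lam :: "nat \<Rightarrow> 'k alg_closure"
    and f :: "'k poly"
    and x y :: 'f
  assumes "CHAR('k) = p" and "p > 0" and "perfect_field TYPE('k)"
    and "N \<ge> 1" and "\<not> p dvd N"
    and "map_poly to_ac f = (\<Prod>i\<le>r. [:- lam i, 1:] ^ A i)"
    and "lam 0 = 0" and "inj_on lam {..r}"
    and "\<And>i. i \<le> r \<Longrightarrow> A i \<ge> 1"
    and "Gcd (insert N (A ` {..r})) = 1"
    and "is_function_field \<iota> N f x y"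
    and "differentials scale \<iota> d"
  defines "cart \<equiv> modified_cartier \<iota> scale d p x y"
    and "C \<equiv> curve_C \<iota> x y"
    and "C_tilde \<equiv> curve_C_tilde \<iota> N (\<Sum>i\<le>r. A i) x y"
  shows "cart ` Omega \<iota> scale d C \<subseteq> Omega \<iota> scale d C \<and>
    cart ` Omega \<iota> scale d C_tilde \<subseteq> Omega \<iota> scale d C_tilde \<and>
    (\<forall>P\<in>C. cart ` Omega_at \<iota> scale d P \<subseteq> Omega_at \<iota> scale d P)"
proof -
  have stable: "cart ` Omega_at \<iota> scale d P \<subseteq> Omega_at \<iota> scale d P"
    if "\<And>h. h \<in> P \<Longrightarrow> h ^ p \<in> P" for P
    unfolding cart_def using modified_cartier_Omega_at[OF assms(1-3,5,11,12) that] by blast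
  have C: "cart ` Omega_at \<iota> scale d P \<subseteq> Omega_at \<iota> scale d P" if "P \<in> C" for P
    using that power_mem_curve_C unfolding C_def by (intro stable) blast
  have "cart ` Omega_at \<iota> scale d P \<subseteq> Omega_at \<iota> scale d P" if "P \<in> C_tilde" for P
  proof (cases "P \<in> C")
    case False
    \<comment> \<open>The points of \<open>C_tilde\<close> outside \<open>C\<close> are places,
      which are subrings by definition.\<close>
    then have "subring P type_ring"
      using that by (auto simp: C_def C_tilde_def curve_C_tilde_def places_def split: if_splits)
    then show ?thesis
      by (intro stable power_mem_subring)
  qed (rule C)
  with C show ?thesis
    unfolding Omega_def by blast
qed

end
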